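(* Let $\mathcal{I}$ be an index set, let $\{\omega_1,\omega_2,\dots\}$ be an at most countably infinite collection of distinct subsets of $\mathcal{I}$, and let $\pi$ be a joint distribution of a pair $(Z,\Omega)$ with $Z\in\mathbb{R}^{\mathcal{I}}$ and $\Omega\in\{\omega_1,\omega_2,\dots\}$. Let $\pi_Z$ be the marginal distribution of $Z$ and let $\pi_i(z)=\mathbb{P}_\pi\{\Omega=\omega_i\mid Z=z\}$. Let $q=(q_1,q_2,\dots)$ be a probability distribution on $\{\omega_1,\omega_2,\dots\}$ and let $\lambda>0$. Let $\mathcal{A}$ be any algorithm that takes as input (possibly partially observed) data and returns outputs in $[0,1]$. Then the algorithm $\mathcal{A}_{\mathrm{PM}(\lambda)}$ constructed via Poissonized missingness satisfies \[\mathbb{E}_{(Z,\Omega)\sim\pi}\Big[\big(\mathcal{A}_{\mathrm{PM}(\lambda)}(Z)-\mathcal{A}_{\mathrm{PM}(\lambda)}(Z_\Omega)\big)^2\Big]\leq\frac{\mathbb{E}_{Z\sim\pi_Z}\big[\sup_i\{\pi_i(Z)/q_i\}\big]}{\lambda}.\]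
   Context: For $z\in\mathbb{R}^{\mathcal{I}}$ and an observation mask $\omega\subseteq\mathcal{I}$, $z_\omega$ denotes the data with missingness, in which only the part of $z$ indexed by $\omega$ is observed (i.e. $\omega$ together with $(z_t)_{t\in\omega}$); $z_{\mathcal{I}}=z$ is fully observed data. Masking partially observed data intersects the masks: $(z_\omega)_{\omega'}=z_{\omega\cap\omega'}$. The algorithm $\mathcal{A}$ is defined on all such inputs $z_\omega$. Poissonized missingness ensembling: for input $z$ (fully or partially observed), \[\mathcal{A}_{\mathrm{PM}(\lambda)}(z)=\mathbb{E}\big[\mathcal{A}(z_{\cap_{j=1}^M\Omega_j})\big],\] where $M\sim\mathrm{Poisson}(\lambda)$ and, given $M$, $\Omega_1,\dots,\Omega_M$ are i.i.d. from $q$ (i.e. $\mathbb{P}\{\Omega_j=\omega_i\}=q_i$). The empty intersection ($M=0$) is the entire set $\mathcal{I}$ (no missingness). Conventions: $\mathbb{R}^{\mathcal{I}}$ carries a $\sigma$-algebra (e.g. the product one) for which the conditional probabilities $\pi_i$ are defined and for which $z\mapsto\mathcal{A}(z_\omega)$ is measurable for every finite intersection $\omega$ of the sets $\omega_i$ (including $\omega=\mathcal{I}$). In the ratio $\pi_i(Z)/q_i$, one takes $0/0=0$ and $a/0=+\infty$ for $a>0$. *)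

theory Defs
  imports "HOL-Probability.Probability"
begin

(* Data with missingness z_w is the partial map with domain w, so that it records exactly w
   together with (z_t) for t in w.  Masking it further by w' is the library operation |`. *)
definition observed :: "('i \<Rightarrow> real) \<Rightarrow> 'i set \<Rightarrow> ('i \<rightharpoonup> real)" where
  "observed z w = (\<lambda>t. Some (z t)) |` w"

(* The intersection with I makes the empty intersection the entire index set. *)
definition mask_Inter :: "'i set \<Rightarrow> 'i set list \<Rightarrow> 'i set" where
  "mask_Inter I ws = I \<inter> \<Inter>(set ws)"

definition poissonized_masks :: "real \<Rightarrow> 'i set pmf \<Rightarrow> 'i set list pmf" where
  "poissonized_masks lam q = bind_pmf (poisson_pmf lam) (\<lambda>m. replicate_pmf m q)"

definition PM ::
  "'i set \<Rightarrow> 'i set pmf \<Rightarrow> real \<Rightarrow> (('i \<rightharpoonup> real) \<Rightarrow> real) \<Rightarrow> ('i \<rightharpoonup> real) \<Rightarrow> real" where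
  "PM I q lam A x =
     measure_pmf.expectation (poissonized_masks lam q) (\<lambda>ws. A (x |` mask_Inter I ws))"

(* p is a version of z |-> P(E | Z = z): a measurable function on the range space N of the
   random variable Z with p(Z) = P(E | sigma(Z)) almost surely. *)
definition is_cond_prob_given ::
  "'a measure \<Rightarrow> 'b measure \<Rightarrow> ('a \<Rightarrow> 'b) \<Rightarrow> 'a set \<Rightarrow> ('b \<Rightarrow> real) \<Rightarrow> bool" where
  "is_cond_prob_given M N Z E p \<longleftrightarrow>
     p \<in> borel_measurable N \<and>
     (AE x in M. p (Z x) = real_cond_exp M (vimage_algebra (space M) Z N) (indicator E) x)"

end

theory Submission
  imports Defs
begin

text \<open>
  For fixed data \<open>z\<close>, let \<open>g\<close> map a list of masks to the output of the algorithm on \<open>z\<close> masked by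
  their intersection. The ensembled output on \<open>z\<close> is \<open>E[g(W)]\<close>, where \<open>W\<close> is a Poisson number of
  independent masks drawn from \<open>q\<close>, and the ensembled output on \<open>z\<close> restricted to \<open>w\<close> is
  \<open>E[g(w # W)]\<close>. So it matters how much the mean of \<open>g\<close> changes when one mask is inserted; write
  \<open>h(w)\<close> for this change.

  Let \<open>H\<close> be the sum of \<open>h\<close> over the masks in \<open>W\<close>. As \<open>g\<close> ignores the order of the masks, the Mecke
  formula for Poisson samples gives \<open>E[g H] = lam * E_q[h(w) E[g(w # W)]]\<close>. Consequently the
  covariance of \<open>g\<close> and \<open>H\<close> is \<open>lam * E_q[h\<^sup>2]\<close>, and this is also the variance of \<open>H\<close>. As \<open>g\<close> takes
  values in \<open>[0, 1]\<close>, the inequality \<open>2 * s * t \<le> s\<^sup>2 + t\<^sup>2\<close> yields \<open>E_q[h\<^sup>2] \<le> 1 / lam\<close>: this is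
  \<open>poissonized_masks_insertion_bound\<close>. The Mecke formula is obtained from its version for a fixed
  number of masks, \<open>expectation_replicate_pmf_marked\<close>, and a shift of the Poisson weights,
  \<open>sums_poisson_shift\<close>.

  It remains to pass from \<open>q\<close> to the true law of the mask. Conditionally on \<open>Z = z\<close> the mask is the
  \<open>i\<close>-th one with probability \<open>p i z\<close> (\<open>nn_integral_cond_prob\<close>), which is at most the mass that \<open>q\<close>
  gives to this mask times the supremum of the ratios, so the conditional mean of \<open>h\<^sup>2\<close> is at most
  this supremum divided by \<open>lam\<close> (\<open>weighted_sum_le_Sup_ratio\<close>).
\<close>

section \<open>Expectations over discrete distributions\<close>

lemma expectation_bind_pmf:
  fixes f :: "'b \<Rightarrow> real"
  assumes bound: "\<And>x y. x \<in> set_pmf p \<Longrightarrow> y \<in> set_pmf (k x) \<Longrightarrow> \<bar>f y\<bar> \<le> B"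
  shows "measure_pmf.expectation (bind_pmf p k) f =
    measure_pmf.expectation p (\<lambda>x. measure_pmf.expectation (k x) f)"
proof -
  \<comment> \<open>Cutting \<open>f\<close> off outside the support makes it bounded everywhere.\<close>
  define f' where "f' = (\<lambda>y. if y \<in> set_pmf (bind_pmf p k) then f y else 0)"
  have f': "\<bar>f' y\<bar> \<le> max B 0" for y
    using bound by (force simp: f'_def set_bind_pmf)
  have "measure_pmf.expectation (bind_pmf p k) f = measure_pmf.expectation (bind_pmf p k) f'"
    by (intro integral_cong_AE) (auto simp: AE_measure_pmf_iff f'_def)
  also have "\<dots> = measure_pmf.expectation p (\<lambda>x. measure_pmf.expectation (k x) f')"
    unfolding measure_pmf_bind
  proof (rule integral_bind[where K = "count_space UNIV" and B = "max B 0" and B' = 1])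
    show "(\<lambda>x. measure_pmf (k x)) \<in> measurable p (subprob_algebra (count_space UNIV))"
      using measurable_measure_pmf[of k] by simp
    show "AE x in p. emeasure (k x) (space (k x)) \<le> ennreal 1"
      using measure_pmf.emeasure_space_1 by (simp add: one_ennreal_def[symmetric])
  qed (use f' in \<open>auto simp: AE_measure_pmf_iff intro: measure_pmf.finite_measure_axioms\<close>)
  also have "\<dots> = measure_pmf.expectation p (\<lambda>x. measure_pmf.expectation (k x) f)"
    by (intro integral_cong_AE) (auto simp: AE_measure_pmf_iff f'_def intro!: integral_cong_AE)
  finally show ?thesis .
qed

lemma integrable_measure_pmf_bounded:
  fixes f :: "'a \<Rightarrow> real"
  assumes "\<And>x. x \<in> set_pmf p \<Longrightarrow> \<bar>f x\<bar> \<le> B"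
  shows "integrable (measure_pmf p) f"
  by (rule measure_pmf.integrable_const_bound[where B = B])
     (use assms in \<open>auto simp: AE_measure_pmf_iff\<close>)

lemma abs_expectation_pmf_le:
  fixes f :: "'a \<Rightarrow> real"
  assumes "\<And>x. x \<in> set_pmf p \<Longrightarrow> \<bar>f x\<bar> \<le> B"
  shows "\<bar>measure_pmf.expectation p f\<bar> \<le> B"
proof -
  have i: "integrable (measure_pmf p) f"
    using assms by (rule integrable_measure_pmf_bounded)
  have "measure_pmf.expectation p f \<le> B"
    by (rule measure_pmf.integral_le_const[OF i]) (use assms in \<open>force simp: AE_measure_pmf_iff\<close>)
  moreover have "- B \<le> measure_pmf.expectation p f"
    by (rule measure_pmf.integral_ge_const[OF i]) (use assms in \<open>force simp: AE_measure_pmf_iff\<close>)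
  ultimately show ?thesis by linarith
qed

lemma expectation_pmf_unit_interval:
  fixes f :: "'a \<Rightarrow> real"
  assumes "\<And>x. f x \<in> {0..1}"
  shows "measure_pmf.expectation p f \<in> {0..1}"
proof -
  have "\<bar>measure_pmf.expectation p f\<bar> \<le> 1"
    using assms by (intro abs_expectation_pmf_le) auto
  moreover have "0 \<le> measure_pmf.expectation p f"
    using assms by (intro integral_nonneg_AE) auto
  ultimately show ?thesis by simp
qed

lemma expectation_pmf_swap:
  fixes f :: "'a \<Rightarrow> 'b \<Rightarrow> real"
  assumes "\<And>x y. x \<in> set_pmf p \<Longrightarrow> y \<in> set_pmf r \<Longrightarrow> \<bar>f x y\<bar> \<le> B"
  shows "measure_pmf.expectation p (\<lambda>x. measure_pmf.expectation r (f x)) =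
    measure_pmf.expectation r (\<lambda>y. measure_pmf.expectation p (\<lambda>x. f x y))"
proof -
  have 1: "measure_pmf.expectation (bind_pmf p (\<lambda>x. map_pmf (Pair x) r)) (case_prod f) =
      measure_pmf.expectation p (\<lambda>x. measure_pmf.expectation r (f x))"
    by (subst expectation_bind_pmf[where B = B]) (use assms in auto)
  have 2: "measure_pmf.expectation (bind_pmf r (\<lambda>y. map_pmf (\<lambda>x. (x, y)) p)) (case_prod f) =
      measure_pmf.expectation r (\<lambda>y. measure_pmf.expectation p (\<lambda>x. f x y))"
    by (subst expectation_bind_pmf[where B = B]) (use assms in auto)
  have "bind_pmf p (\<lambda>x. map_pmf (Pair x) r) = bind_pmf r (\<lambda>y. map_pmf (\<lambda>x. (x, y)) p)"
    unfolding map_pmf_def by (rule bind_commute_pmf)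
  with 1 2 show ?thesis by simp
qed

section \<open>Marked samples and Poisson weights\<close>

lemma expectation_replicate_pmf_Suc:
  fixes f :: "'a list \<Rightarrow> real"
  assumes "\<And>xs. length xs = Suc m \<Longrightarrow> \<bar>f xs\<bar> \<le> B"
  shows "measure_pmf.expectation (replicate_pmf (Suc m) q) f =
    measure_pmf.expectation q (\<lambda>w. measure_pmf.expectation (replicate_pmf m q) (\<lambda>ws. f (w # ws)))"
proof -
  have "replicate_pmf (Suc m) q = bind_pmf q (\<lambda>w. map_pmf ((#) w) (replicate_pmf m q))"
    by (simp add: map_pmf_def)
  then show ?thesis
    by (subst \<open>replicate_pmf (Suc m) q = _\<close>, subst expectation_bind_pmf[where B = B])
       (use assms in \<open>auto simp: set_replicate_pmf\<close>)
qed

lemma abs_sum_list_map_le: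
  fixes h :: "'a \<Rightarrow> real"
  assumes "\<And>w. \<bar>h w\<bar> \<le> C"
  shows "\<bar>\<Sum>w\<leftarrow>ws. h w\<bar> \<le> real (length ws) * C"
proof (induction ws)
  case (Cons w ws)
  then show ?case using assms[of w] by (simp add: algebra_simps)
qed simp

text \<open>
  Weighting a symmetric \<open>f\<close> by a sum over the marks amounts to choosing one of the \<open>m + 1\<close>
  exchangeable marks: since \<open>f\<close> does not see the order, the chosen mark may be put in front.
\<close>
lemma expectation_replicate_pmf_marked:
  fixes h :: "'a \<Rightarrow> real" and f :: "'a list \<Rightarrow> real"
  assumes sym: "\<And>xs ys. mset xs = mset ys \<Longrightarrow> f xs = f ys"
    and f: "\<And>xs. length xs = Suc m \<Longrightarrow> \<bar>f xs\<bar> \<le> B"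
    and h: "\<And>w. \<bar>h w\<bar> \<le> C"
  shows "measure_pmf.expectation (replicate_pmf (Suc m) q) (\<lambda>ws. (\<Sum>w\<leftarrow>ws. h w) * f ws) =
    real (Suc m) *
    measure_pmf.expectation q (\<lambda>w. h w * measure_pmf.expectation (replicate_pmf m q) (\<lambda>ws. f (w # ws)))"
  using sym f
proof (induction m arbitrary: f)
  case 0
  have "\<bar>(\<Sum>w\<leftarrow>xs. h w) * f xs\<bar> \<le> C * B" if "length xs = Suc 0" for xs
    unfolding abs_mult using 0(2)[OF that] abs_sum_list_map_le[of h C xs] h that
    by (intro mult_mono) (auto intro: order_trans[OF abs_ge_zero])
  then have "measure_pmf.expectation (replicate_pmf (Suc 0) q) (\<lambda>ws. (\<Sum>w\<leftarrow>ws. h w) * f ws) =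
      measure_pmf.expectation q (\<lambda>w. measure_pmf.expectation (replicate_pmf 0 q)
        (\<lambda>ws. (\<Sum>w\<leftarrow>w # ws. h w) * f (w # ws)))"
    by (rule expectation_replicate_pmf_Suc)
  then show ?case
    by (simp del: replicate_pmf.simps(2))
next
  case (Suc m)
  let ?E = "\<lambda>m. measure_pmf.expectation (replicate_pmf m q)"
  have in_replicate: "length ws = n" if "ws \<in> set_pmf (replicate_pmf n q)" for n and ws :: "'a list"
    using that by (simp add: set_replicate_pmf)
  have C: "0 \<le> C" using h[of undefined] by linarith
  have fC: "\<bar>f (w # ws)\<bar> \<le> B" if "length ws = Suc m" for w ws
    using that by (intro Suc.prems(2)) simp
  have B: "0 \<le> B" using fC[of "replicate (Suc m) undefined" undefined] by simp
  have hf: "\<bar>h v * f (w # ws)\<bar> \<le> C * B" if "length ws = Suc m" for v w ws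
    unfolding abs_mult using fC[OF that] h C by (intro mult_mono) auto
  have sf: "\<bar>(\<Sum>w\<leftarrow>ws. h w) * f (v # ws)\<bar> \<le> real (Suc m) * C * B" if "length ws = Suc m" for v ws
    unfolding abs_mult using fC[OF that] abs_sum_list_map_le[of h C ws] h C that
    by (intro mult_mono) auto
  have "?E (Suc (Suc m)) (\<lambda>ws. (\<Sum>w\<leftarrow>ws. h w) * f ws) =
      measure_pmf.expectation q (\<lambda>w. ?E (Suc m) (\<lambda>ws. (\<Sum>w\<leftarrow>w # ws. h w) * f (w # ws)))"
  proof (rule expectation_replicate_pmf_Suc)
    fix xs :: "'a list" assume xs: "length xs = Suc (Suc m)"
    show "\<bar>(\<Sum>w\<leftarrow>xs. h w) * f xs\<bar> \<le> real (Suc (Suc m)) * C * B"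
      unfolding abs_mult using Suc.prems(2)[OF xs] abs_sum_list_map_le[of h C xs] h C xs
      by (intro mult_mono) auto
  qed
  \<comment> \<open>The summand of the first mark already has the required form; the induction hypothesis
    applies to the remaining sum, for the symmetric function that has \<open>w\<close> prepended.\<close>
  also have "\<dots> = measure_pmf.expectation q (\<lambda>w. h w * ?E (Suc m) (\<lambda>ws. f (w # ws)) +
      ?E (Suc m) (\<lambda>ws. (\<Sum>w\<leftarrow>ws. h w) * f (w # ws)))"
  proof (rule Bochner_Integration.integral_cong[OF refl])
    fix w
    have "?E (Suc m) (\<lambda>ws. (\<Sum>w\<leftarrow>w # ws. h w) * f (w # ws)) =
        ?E (Suc m) (\<lambda>ws. h w * f (w # ws) + (\<Sum>w\<leftarrow>ws. h w) * f (w # ws))"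
      by (simp add: algebra_simps)
    also have "\<dots> = ?E (Suc m) (\<lambda>ws. h w * f (w # ws)) +
        ?E (Suc m) (\<lambda>ws. (\<Sum>w\<leftarrow>ws. h w) * f (w # ws))"
      by (intro Bochner_Integration.integral_add;
          rule integrable_measure_pmf_bounded, rule hf sf, drule in_replicate)
    finally show "?E (Suc m) (\<lambda>ws. (\<Sum>w\<leftarrow>w # ws. h w) * f (w # ws)) =
        h w * ?E (Suc m) (\<lambda>ws. f (w # ws)) + ?E (Suc m) (\<lambda>ws. (\<Sum>w\<leftarrow>ws. h w) * f (w # ws))"
      by (simp del: replicate_pmf.simps)
  qed
  also have "\<dots> = measure_pmf.expectation q (\<lambda>w. h w * ?E (Suc m) (\<lambda>ws. f (w # ws))) +
      measure_pmf.expectation q (\<lambda>w. ?E (Suc m) (\<lambda>ws. (\<Sum>w\<leftarrow>ws. h w) * f (w # ws)))"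
  proof (rule Bochner_Integration.integral_add)
    have "\<bar>h w * ?E (Suc m) (\<lambda>ws. f (w # ws))\<bar> \<le> C * B" for w
      unfolding abs_mult using C h fC
      by (intro mult_mono abs_expectation_pmf_le) (auto dest!: in_replicate simp del: replicate_pmf.simps)
    then show "integrable q (\<lambda>w. h w * ?E (Suc m) (\<lambda>ws. f (w # ws)))"
      by (rule integrable_measure_pmf_bounded)
    have "\<bar>?E (Suc m) (\<lambda>ws. (\<Sum>w\<leftarrow>ws. h w) * f (w # ws))\<bar> \<le> real (Suc m) * C * B" for w
      by (rule abs_expectation_pmf_le, rule sf, drule in_replicate)
    then show "integrable q (\<lambda>w. ?E (Suc m) (\<lambda>ws. (\<Sum>w\<leftarrow>ws. h w) * f (w # ws)))"
      by (rule integrable_measure_pmf_bounded)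
  qed
  also have "measure_pmf.expectation q (\<lambda>w. ?E (Suc m) (\<lambda>ws. (\<Sum>w\<leftarrow>ws. h w) * f (w # ws))) =
      measure_pmf.expectation q (\<lambda>w. real (Suc m) *
        measure_pmf.expectation q (\<lambda>v. h v * ?E m (\<lambda>ws. f (w # v # ws))))"
  proof (rule Bochner_Integration.integral_cong[OF refl], rule Suc.IH)
    show "f (w # xs) = f (w # ys)" if "mset xs = mset ys" for w xs ys
      using that by (intro Suc.prems(1)) simp
  qed (rule fC)
  \<comment> \<open>Exchanging \<open>v\<close> and \<open>w\<close> lets the symmetry of \<open>f\<close> move the chosen mark to the front.\<close>
  also have "\<dots> = real (Suc m) * measure_pmf.expectation q (\<lambda>v.
        measure_pmf.expectation q (\<lambda>w. h v * ?E m (\<lambda>ws. f (w # v # ws))))"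
  proof -
    have "\<bar>h v * ?E m (\<lambda>ws. f (w # v # ws))\<bar> \<le> C * B" for v w
      unfolding abs_mult using C h fC
      by (intro mult_mono abs_expectation_pmf_le) (auto dest!: in_replicate)
    then show ?thesis
      by (subst expectation_pmf_swap[where B = "C * B"]) auto
  qed
  also have "(\<lambda>v. measure_pmf.expectation q (\<lambda>w. h v * ?E m (\<lambda>ws. f (w # v # ws)))) =
      (\<lambda>v. h v * ?E (Suc m) (\<lambda>ws. f (v # ws)))"
  proof
    fix v
    have "f (w # v # ws) = f (v # w # ws)" for w ws
      by (rule Suc.prems(1)) simp
    then show "measure_pmf.expectation q (\<lambda>w. h v * ?E m (\<lambda>ws. f (w # v # ws))) =
        h v * ?E (Suc m) (\<lambda>ws. f (v # ws))"
      using expectation_replicate_pmf_Suc[of m "\<lambda>ws. f (v # ws)" B q] fC by simp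
  qed
  finally show ?case
    by (simp add: algebra_simps del: replicate_pmf.simps)
qed

lemma sums_expectation_pmf:
  fixes x :: "nat \<Rightarrow> real"
  assumes "\<And>m. \<bar>x m\<bar> \<le> B"
  shows "(\<lambda>m. pmf p m * x m) sums measure_pmf.expectation p x"
proof -
  have "integrable (measure_pmf p) x"
    using assms by (rule integrable_measure_pmf_bounded)
  then have "integrable (count_space UNIV) (\<lambda>m. pmf p m * x m)"
    unfolding measure_pmf_eq_density by (subst (asm) integrable_density) auto
  from sums_integral_count_space_nat[OF this] show ?thesis
    unfolding measure_pmf_eq_density by (subst integral_density) auto
qed

text \<open>
  This is the size-biasing identity \<open>E[M x(M - 1)] = lam E[x(M)]\<close>, a term-by-term shift of the Poisson
  weights. For \<open>m = 0\<close> the factor \<open>real m\<close> removes the truncated difference \<open>m - 1\<close>.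
\<close>
lemma sums_poisson_shift:
  fixes x :: "nat \<Rightarrow> real"
  assumes lam: "lam > 0" and x: "(\<lambda>m. pmf (poisson_pmf lam) m * x m) sums s"
  shows "(\<lambda>m. pmf (poisson_pmf lam) m * (real m * x (m - 1))) sums (lam * s)"
proof -
  have "(\<lambda>m. lam * (pmf (poisson_pmf lam) m * x m)) sums (lam * s)"
    using x by (rule sums_mult)
  also have "(\<lambda>m. lam * (pmf (poisson_pmf lam) m * x m)) =
      (\<lambda>m. pmf (poisson_pmf lam) (Suc m) * (real (Suc m) * x (Suc m - 1)))"
  proof
    fix m
    have "real (Suc m) / fact (Suc m) = 1 / fact m"
      by (simp del: of_nat_Suc)
    then have "pmf (poisson_pmf lam) (Suc m) * real (Suc m) = lam * pmf (poisson_pmf lam) m"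
      using lam by (simp add: divide_inverse mult_ac del: fact_Suc of_nat_Suc)
    then show "lam * (pmf (poisson_pmf lam) m * x m) =
        pmf (poisson_pmf lam) (Suc m) * (real (Suc m) * x (Suc m - 1))"
      by simp
  qed
  finally show ?thesis
    by (subst (asm) sums_Suc_iff) simp
qed

section \<open>Sensitivity to one extra mask\<close>

lemma expectation_poissonized_masks:
  fixes f :: "'i set list \<Rightarrow> real"
  assumes "\<And>ws. \<bar>f ws\<bar> \<le> B"
  shows "measure_pmf.expectation (poissonized_masks lam q) f =
    measure_pmf.expectation (poisson_pmf lam) (\<lambda>m. measure_pmf.expectation (replicate_pmf m q) f)"
  unfolding poissonized_masks_def by (rule expectation_bind_pmf) (rule assms)

text \<open>
  With \<open>h w\<close> the change in the mean of \<open>g\<close> caused by inserting the mask \<open>w\<close>, let \<open>H\<close> be the sum of \<open>h\<close>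
  over the sampled masks, so that \<open>H\<close> has mean \<open>lam * a\<close> with \<open>a = E_q[h]\<close>, and variance \<open>lam * V\<close>
  with \<open>V = E_q[h\<^sup>2]\<close>. The covariance of \<open>g\<close> and \<open>H\<close> is also \<open>lam * V\<close>, because inserting a mask is
  how marking acts on the Poisson sample. Hence \<open>2 * lam * V \<le> E[g\<^sup>2] + lam * V \<le> 1 + lam * V\<close>.
  All moments are computed for a fixed number \<open>m\<close> of masks, where \<open>H\<close> is bounded, and only then
  averaged over the Poisson weights.
\<close>
lemma poissonized_masks_insertion_bound:
  fixes g :: "'i set list \<Rightarrow> real" and q :: "'i set pmf"
  assumes lam: "lam > 0"
    and sym: "\<And>xs ys. mset xs = mset ys \<Longrightarrow> g xs = g ys"
    and g: "\<And>ws. g ws \<in> {0..1}"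
  defines "E \<equiv> measure_pmf.expectation (poissonized_masks lam q)"
  shows "measure_pmf.expectation q (\<lambda>w. (E g - E (\<lambda>ws. g (w # ws)))\<^sup>2) \<le> 1 / lam"
proof -
  let ?T = "\<lambda>m. measure_pmf.expectation (replicate_pmf m q)"
  let ?Q = "measure_pmf.expectation q"
  let ?P = "\<lambda>m. pmf (poisson_pmf lam) m"
  define h where "h = (\<lambda>w. E (\<lambda>ws. g (w # ws)) - E g)"
  define H where "H = (\<lambda>ws. \<Sum>w\<leftarrow>ws. h w)"
  define a where "a = ?Q h"
  define V where "V = ?Q (\<lambda>w. (h w)\<^sup>2)"
  \<comment> \<open>Conditional means given \<open>m\<close> masks: of \<open>g\<close>, of \<open>g\<close> with \<open>w\<close> inserted, and of the latter
    averaged over \<open>w\<close> with weight \<open>h w\<close>.\<close>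
  define x where "x = (\<lambda>m. ?T m g)"
  define u where "u = (\<lambda>m w. ?T m (\<lambda>ws. g (w # ws)))"
  define y where "y = (\<lambda>m. ?Q (\<lambda>w. h w * u m w))"
  have g01: "0 \<le> g ws" "g ws \<le> 1" and g1: "\<bar>g ws\<bar> \<le> 1" for ws
    using g[of ws] by auto
  have E01: "E f \<in> {0..1}" if "\<And>ws. f ws \<in> {0..1}" for f
    unfolding E_def using that by (rule expectation_pmf_unit_interval)
  have h1: "\<bar>h w\<bar> \<le> 1" for w
    using E01[of g] E01[of "\<lambda>ws. g (w # ws)"] g unfolding h_def by (auto simp: abs_le_iff)
  have h2: "\<bar>(h w)\<^sup>2\<bar> \<le> 1" for w
    using h1[of w] by (simp add: abs_square_le_1)
  have x1: "\<bar>x m\<bar> \<le> 1" for m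
    unfolding x_def by (rule abs_expectation_pmf_le) (rule g1)
  have u1: "\<bar>u m w\<bar> \<le> 1" for m w
    unfolding u_def by (rule abs_expectation_pmf_le) (rule g1)
  have hu1: "\<bar>h w * u m w\<bar> \<le> 1" for m w
    unfolding abs_mult using mult_mono[OF h1 u1] by simp
  have y1: "\<bar>y m\<bar> \<le> 1" for m
    unfolding y_def by (rule abs_expectation_pmf_le) (rule hu1)
  have H_le: "\<bar>H ws\<bar> \<le> real (length ws)" for ws
    using abs_sum_list_map_le[of h 1 ws] h1 unfolding H_def by simp
  have in_replicate: "length ws = m" if "ws \<in> set_pmf (replicate_pmf m q)" for m ws
    using that by (simp add: set_replicate_pmf)
  have int_T: "integrable (replicate_pmf m q) f"
    if "\<And>ws. length ws = m \<Longrightarrow> \<bar>f ws\<bar> \<le> bd" for m bd and f :: "'i set list \<Rightarrow> real"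
    by (rule integrable_measure_pmf_bounded, rule that, rule in_replicate)
  have H_sym: "H xs = H ys" if "mset xs = mset ys" for xs ys
    using that unfolding H_def by (metis mset_map sum_mset_sum_list)

  have T_H: "?T m H = real m * a" for m
  proof (cases m)
    case (Suc n)
    then show ?thesis
      using expectation_replicate_pmf_marked[of "\<lambda>_. 1" n 1 h 1 q] h1
      by (simp add: H_def a_def del: replicate_pmf.simps)
  qed (simp add: H_def)
  have int_h: "integrable q h" "integrable q (\<lambda>w. (h w)\<^sup>2)"
    by (rule integrable_measure_pmf_bounded, rule h1, rule integrable_measure_pmf_bounded, rule h2)
  have int_H: "integrable (replicate_pmf m q) H" for m
    by (rule int_T[of _ _ "real m"]) (use H_le in force)
  have int_HH: "integrable (replicate_pmf m q) (\<lambda>ws. (H ws)\<^sup>2)" for m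
    by (rule int_T[of _ _ "(real m)\<^sup>2"]) (use H_le in \<open>force simp: abs_le_square_iff[symmetric]\<close>)
  have int_g: "integrable (replicate_pmf m q) g" for m
    by (rule int_T) (rule g1)
  have int_gH: "integrable (replicate_pmf m q) (\<lambda>ws. H ws * g ws)" for m
  proof (rule int_T)
    fix ws :: "'i set list" assume "length ws = m"
    then show "\<bar>H ws * g ws\<bar> \<le> real m * 1"
      unfolding abs_mult using H_le[of ws] by (intro mult_mono g1) auto
  qed
  have T_HH: "?T m (\<lambda>ws. (H ws)\<^sup>2) = real m * V + real m * (real (m - 1) * a\<^sup>2)" for m
  proof (cases m)
    case (Suc n)
    have "?T m (\<lambda>ws. (H ws)\<^sup>2) = ?T (Suc n) (\<lambda>ws. (\<Sum>w\<leftarrow>ws. h w) * H ws)"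
      by (simp add: Suc H_def power2_eq_square del: replicate_pmf.simps)
    also have "\<dots> = real (Suc n) * ?Q (\<lambda>w. h w * ?T n (\<lambda>ws. H (w # ws)))"
    proof (rule expectation_replicate_pmf_marked)
      show "\<bar>H ws\<bar> \<le> real (Suc n)" if "length ws = Suc n" for ws
        using H_le[of ws] that by simp
    qed (fact H_sym h1)+
    also have "(\<lambda>w. h w * ?T n (\<lambda>ws. H (w # ws))) = (\<lambda>w. (h w)\<^sup>2 + h w * (real n * a))"
    proof
      fix w
      have "?T n (\<lambda>ws. H (w # ws)) = ?T n (\<lambda>ws. h w + H ws)"
        by (simp add: H_def)
      also have "\<dots> = h w + real n * a"
        by (subst Bochner_Integration.integral_add) (simp_all add: int_H T_H)
      finally show "h w * ?T n (\<lambda>ws. H (w # ws)) = (h w)\<^sup>2 + h w * (real n * a)"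
        by (simp add: power2_eq_square algebra_simps)
    qed
    also have "?Q (\<lambda>w. (h w)\<^sup>2 + h w * (real n * a)) = V + a * (real n * a)"
      by (subst Bochner_Integration.integral_add) (use int_h in \<open>simp_all add: V_def a_def\<close>)
    finally show ?thesis
      by (simp add: Suc power2_eq_square algebra_simps)
  qed (simp add: H_def)
  have T_gH: "?T m (\<lambda>ws. H ws * g ws) = real m * y (m - 1)" for m
  proof (cases m)
    case (Suc n)
    show ?thesis
      unfolding Suc H_def y_def u_def diff_Suc_1
      by (rule expectation_replicate_pmf_marked[where B = 1 and C = 1]) (erule sym | rule g1 h1)+
  qed (simp add: H_def)

  have step: "2 * (real m * y (m - 1) - lam * a * x m) \<le>
      1 + lam\<^sup>2 * a\<^sup>2 + real m * V + real m * (real (m - 1) * a\<^sup>2) - 2 * lam * a\<^sup>2 * real m" for m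
  proof -
    have "2 * (real m * y (m - 1) - lam * a * x m) = ?T m (\<lambda>ws. 2 * (H ws * g ws - lam * a * g ws))"
      using int_gH int_g by (simp add: T_gH x_def)
    also have "\<dots> \<le> ?T m (\<lambda>ws. 1 + lam\<^sup>2 * a\<^sup>2 + (H ws)\<^sup>2 - 2 * lam * a * H ws)"
    proof (rule integral_mono)
      fix ws
      \<comment> \<open>Young's inequality \<open>2 * s * t \<le> s\<^sup>2 + t\<^sup>2\<close> for \<open>g\<close> and the centred \<open>H\<close>.\<close>
      have "0 \<le> (g ws - (H ws - lam * a))\<^sup>2" "(g ws)\<^sup>2 \<le> 1"
        using g1[of ws] by (simp_all add: abs_square_le_1)
      then show "2 * (H ws * g ws - lam * a * g ws) \<le> 1 + lam\<^sup>2 * a\<^sup>2 + (H ws)\<^sup>2 - 2 * lam * a * H ws"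
        by (simp add: power2_eq_square algebra_simps)
    qed (use int_gH int_g int_H int_HH in auto)
    also have "\<dots> = 1 + lam\<^sup>2 * a\<^sup>2 + ?T m (\<lambda>ws. (H ws)\<^sup>2) - 2 * lam * a * ?T m H"
      using int_H[of m] int_HH[of m] by simp
    finally show ?thesis
      unfolding T_HH T_H by (simp add: power2_eq_square algebra_simps)
  qed

  \<comment> \<open>Poisson averages of both sides of the inequality just proved.\<close>
  have s1: "?P sums 1"
    using sums_expectation_pmf[of "\<lambda>_. 1" 1 "poisson_pmf lam"] by simp
  have sm: "(\<lambda>m. ?P m * real m) sums lam"
    using sums_poisson_shift[OF lam, of "\<lambda>_. 1" 1] s1 by simp
  have smm: "(\<lambda>m. ?P m * (real m * real (m - 1))) sums lam\<^sup>2"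
    using sums_poisson_shift[OF lam sm] by (simp add: power2_eq_square)
  define X where "X = measure_pmf.expectation (poisson_pmf lam) x"
  define Y where "Y = measure_pmf.expectation (poisson_pmf lam) y"
  have sx: "(\<lambda>m. ?P m * x m) sums X"
    unfolding X_def by (rule sums_expectation_pmf) (rule x1)
  have "(\<lambda>m. ?P m * y m) sums Y"
    unfolding Y_def by (rule sums_expectation_pmf) (rule y1)
  then have sy: "(\<lambda>m. ?P m * (real m * y (m - 1))) sums (lam * Y)"
    by (rule sums_poisson_shift[OF lam])
  have "(\<lambda>m. 2 * (?P m * (real m * y (m - 1))) - 2 * lam * a * (?P m * x m)) sums
      (2 * (lam * Y) - 2 * lam * a * X)"
    by (intro sums_diff sums_mult sx sy)
  moreover have "(\<lambda>m. (1 + lam\<^sup>2 * a\<^sup>2) * ?P m + V * (?P m * real m) +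
        a\<^sup>2 * (?P m * (real m * real (m - 1))) - 2 * lam * a\<^sup>2 * (?P m * real m)) sums
      ((1 + lam\<^sup>2 * a\<^sup>2) * 1 + V * lam + a\<^sup>2 * lam\<^sup>2 - 2 * lam * a\<^sup>2 * lam)"
    by (intro sums_diff sums_add sums_mult s1 sm smm)
  ultimately have "2 * (lam * Y) - 2 * lam * a * X \<le>
      (1 + lam\<^sup>2 * a\<^sup>2) * 1 + V * lam + a\<^sup>2 * lam\<^sup>2 - 2 * lam * a\<^sup>2 * lam"
  proof (rule sums_le[rotated])
    fix m
    show "2 * (?P m * (real m * y (m - 1))) - 2 * lam * a * (?P m * x m) \<le>
        (1 + lam\<^sup>2 * a\<^sup>2) * ?P m + V * (?P m * real m) +
        a\<^sup>2 * (?P m * (real m * real (m - 1))) - 2 * lam * a\<^sup>2 * (?P m * real m)"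
      using mult_left_mono[OF step[of m] pmf_nonneg[of "poisson_pmf lam" m]]
      by (simp only: ring_distribs mult_ac)
  qed
  then have main: "2 * (lam * (Y - a * X)) \<le> 1 + lam * V"
    by (simp add: power2_eq_square algebra_simps)

  \<comment> \<open>By the choice of \<open>h\<close>, the covariance term on the left is \<open>V\<close> itself.\<close>
  have X: "X = E g"
    unfolding X_def x_def E_def by (rule expectation_poissonized_masks[symmetric]) (rule g1)
  have "Y = ?Q (\<lambda>w. measure_pmf.expectation (poisson_pmf lam) (\<lambda>m. h w * u m w))"
    unfolding Y_def y_def by (rule expectation_pmf_swap) (rule hu1)
  also have "\<dots> = ?Q (\<lambda>w. h w * E (\<lambda>ws. g (w # ws)))"
    unfolding u_def E_def by (subst expectation_poissonized_masks[where B = 1]) (auto intro: g1)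
  also have "\<dots> = ?Q (\<lambda>w. (h w)\<^sup>2 + h w * X)"
    by (intro Bochner_Integration.integral_cong refl)
       (simp add: X h_def power2_eq_square algebra_simps)
  also have "\<dots> = V + a * X"
    by (subst Bochner_Integration.integral_add) (use int_h in \<open>simp_all add: V_def a_def\<close>)
  finally have "lam * V \<le> 1"
    using main by (simp add: algebra_simps)
  then have "V \<le> 1 / lam"
    using lam by (simp add: field_simps)
  then show ?thesis
    unfolding V_def h_def by (simp add: power2_commute)
qed

section \<open>Conditional probabilities and the ratio bound\<close>

text \<open>
  The integrand \<open>\<phi>\<close> is measurable for the sigma-algebra generated by \<open>Z\<close>, so the indicator of \<open>E\<close> may
  be replaced by its conditional probability.
\<close>
lemma nn_integral_cond_prob:
  assumes "prob_space M" and Z [measurable]: "Z \<in> measurable M N" and E [measurable]: "E \<in> sets M"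
    and p: "is_cond_prob_given M N Z E p"
    and \<phi> [measurable]: "\<phi> \<in> borel_measurable N"
  shows "(\<integral>\<^sup>+x. \<phi> (Z x) * indicator E x \<partial>M) = (\<integral>\<^sup>+x. \<phi> (Z x) * ennreal (p (Z x)) \<partial>M)"
proof -
  interpret prob_space M by fact
  define F where "F = vimage_algebra (space M) Z N"
  have Z_in: "Z \<in> space M \<rightarrow> space N"
    using measurable_space[OF Z] by auto
  have "subalgebra M F"
    using Z by (auto simp: subalgebra_def F_def sets_vimage_algebra2[OF Z_in] intro: measurable_sets)
  then interpret finite_measure_subalgebra M F
    by unfold_locales
  have [measurable]: "(\<lambda>x. \<phi> (Z x)) \<in> borel_measurable F"
    unfolding F_def using measurable_vimage_algebra1[OF Z_in] by measurable
  let ?e = "nn_cond_exp M F (\<lambda>x. ennreal (indicator E x))"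
  \<comment> \<open>The real conditional expectation is the difference of those of the positive and the negative
    part. The former is almost surely finite and the latter vanishes, so \<open>p (Z x)\<close> is \<open>?e x\<close>.\<close>
  have "(\<integral>\<^sup>+x. 1 * ?e x \<partial>M) = (\<integral>\<^sup>+x. 1 * ennreal (indicator E x) \<partial>M)"
    by (rule nn_cond_exp_intg) auto
  also have "\<dots> = emeasure M E"
    by (simp add: ennreal_indicator)
  finally have "AE x in M. ?e x \<noteq> \<infinity>"
    by (intro nn_integral_noteq_infinite) auto
  moreover have "AE x in M. nn_cond_exp M F (\<lambda>x. ennreal (- indicator E x)) x = 0"
  proof -
    have "(\<lambda>x. ennreal (- indicator E x)) = (\<lambda>x. 0)"
      by (auto simp: indicator_def ennreal_neg)
    moreover have "(\<integral>\<^sup>+x. 1 * nn_cond_exp M F (\<lambda>x. 0) x \<partial>M) = (\<integral>\<^sup>+x. 1 * 0 \<partial>M)"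
      by (rule nn_cond_exp_intg) auto
    ultimately show ?thesis
      by (simp add: nn_integral_0_iff_AE)
  qed
  moreover have "AE x in M. p (Z x) = real_cond_exp M F (indicator E) x"
    using p by (simp add: is_cond_prob_given_def F_def)
  ultimately have "AE x in M. ?e x = ennreal (p (Z x))"
    by eventually_elim (simp add: real_cond_exp_def less_top)
  then have "(\<integral>\<^sup>+x. \<phi> (Z x) * ennreal (p (Z x)) \<partial>M) = (\<integral>\<^sup>+x. \<phi> (Z x) * ?e x \<partial>M)"
    by (intro nn_integral_cong_AE) auto
  also have "\<dots> = (\<integral>\<^sup>+x. \<phi> (Z x) * ennreal (indicator E x) \<partial>M)"
    by (rule nn_cond_exp_intg) auto
  finally show ?thesis
    by (simp add: ennreal_indicator)
qed

text \<open>Measurability is needed only on the support, which is countable.\<close>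
lemma borel_measurable_expectation_pmf:
  fixes f :: "'a \<Rightarrow> 'b \<Rightarrow> real"
  assumes "\<And>y. y \<in> set_pmf r \<Longrightarrow> (\<lambda>x. f x y) \<in> borel_measurable M"
  shows "(\<lambda>x. measure_pmf.expectation r (f x)) \<in> borel_measurable M"
proof -
  interpret R: prob_space "restrict_space (measure_pmf r) (set_pmf r)"
    by (intro prob_space_restrict_space measure_pmf.emeasure_eq_1_AE) (auto simp: AE_measure_pmf_iff)
  have "(\<lambda>x. \<integral>y. f x y \<partial>restrict_space (measure_pmf r) (set_pmf r)) \<in> borel_measurable M"
    by (intro R.borel_measurable_lebesgue_integral measurable_pair_restrict_pmf2)
       (use assms in auto)
  then show ?thesis
    by (subst integral_pmf_restrict) auto
qed

text \<open>
  Unless the supremum \<open>S\<close> is infinite, \<open>P i\<close> is at most \<open>S\<close> times the mass of \<open>\<omega> i\<close>; in particular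
  \<open>P i = 0\<close> where that mass vanishes, since \<open>a / 0 = \<top>\<close> for \<open>a > 0\<close> in \<^typ>\<open>ennreal\<close>.
\<close>
lemma weighted_sum_le_Sup_ratio:
  fixes q :: "'b pmf" and \<psi> :: "'b \<Rightarrow> real" and P :: "nat \<Rightarrow> ennreal"
  assumes inj: "inj_on \<omega> J" and q: "set_pmf q \<subseteq> \<omega> ` J"
    and \<psi>: "\<And>w. 0 \<le> \<psi> w" "\<And>w. \<psi> w \<le> C"
    and bound: "measure_pmf.expectation q \<psi> \<le> 1 / lam" and lam: "lam > 0"
    and P: "\<And>i. P i < \<top>"
  shows "(\<integral>\<^sup>+i. ennreal (\<psi> (\<omega> i)) * P i \<partial>count_space J) \<le>
    (\<Squnion>i\<in>J. P i / ennreal (pmf q (\<omega> i))) / ennreal lam"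
proof -
  define S where "S = (\<Squnion>i\<in>J. P i / ennreal (pmf q (\<omega> i)))"
  show ?thesis
  proof (cases "S = \<top>")
    case True
    then show ?thesis
      by (simp add: S_def[symmetric] ennreal_top_divide)
  next
    case False
    have le: "P i \<le> S * ennreal (pmf q (\<omega> i))" if i: "i \<in> J" for i
    proof -
      have S: "P i / ennreal (pmf q (\<omega> i)) \<le> S"
        unfolding S_def using i by (rule SUP_upper)
      show ?thesis
      proof (cases "pmf q (\<omega> i) = 0")
        case True
        then show ?thesis
          using S False by (cases "P i = 0") (auto simp: ennreal_divide_zero top_unique)
      next
        case nz: False
        then have "P i = P i / ennreal (pmf q (\<omega> i)) * ennreal (pmf q (\<omega> i))"
          using pmf_nonneg[of q "\<omega> i"]
          by (simp add: ennreal_divide_times mult.commute[of "P i"] ennreal_mult_divide_eq)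
        also have "\<dots> \<le> S * ennreal (pmf q (\<omega> i))"
          using S by (rule mult_right_mono) simp
        finally show ?thesis .
      qed
    qed
    have "(\<integral>\<^sup>+i. ennreal (\<psi> (\<omega> i)) * P i \<partial>count_space J) \<le>
        (\<integral>\<^sup>+i. S * (ennreal (pmf q (\<omega> i)) * ennreal (\<psi> (\<omega> i))) \<partial>count_space J)"
    proof (rule nn_integral_mono)
      fix i assume "i \<in> space (count_space J)"
      then have "ennreal (\<psi> (\<omega> i)) * P i \<le> ennreal (\<psi> (\<omega> i)) * (S * ennreal (pmf q (\<omega> i)))"
        by (intro mult_left_mono le) auto
      then show "ennreal (\<psi> (\<omega> i)) * P i \<le> S * (ennreal (pmf q (\<omega> i)) * ennreal (\<psi> (\<omega> i)))"
        by (simp add: mult_ac)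
    qed
    also have "\<dots> = S * (\<integral>\<^sup>+i. ennreal (pmf q (\<omega> i)) * ennreal (\<psi> (\<omega> i)) \<partial>count_space J)"
      by (rule nn_integral_cmult) simp
    also have "(\<integral>\<^sup>+i. ennreal (pmf q (\<omega> i)) * ennreal (\<psi> (\<omega> i)) \<partial>count_space J) =
        (\<integral>\<^sup>+w. ennreal (pmf q w) * ennreal (\<psi> w) \<partial>count_space (\<omega> ` J))"
      by (rule nn_integral_bij_count_space) (use inj in \<open>simp add: bij_betw_def\<close>)
    also have "\<dots> = (\<integral>\<^sup>+w. ennreal (pmf q w) * ennreal (\<psi> w) \<partial>count_space UNIV)"
      using q by (subst nn_integral_count_space_indicator)
        (auto intro!: nn_integral_cong simp: indicator_def set_pmf_eq)
    also have "\<dots> = (\<integral>\<^sup>+w. ennreal (\<psi> w) \<partial>q)"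
      by (rule nn_integral_measure_pmf[symmetric])
    also have "\<dots> = ennreal (measure_pmf.expectation q \<psi>)"
      using \<psi> by (intro nn_integral_eq_integral integrable_measure_pmf_bounded[where B = C]) auto
    also have "S * \<dots> \<le> S * ennreal (1 / lam)"
      using bound by (intro mult_left_mono ennreal_leI) auto
    also have "\<dots> = S / ennreal lam"
      using lam by (simp add: divide_ennreal_def inverse_ennreal inverse_eq_divide)
    finally show ?thesis
      by (simp add: S_def)
  qed
qed

section \<open>Stability of Poissonized missingness ensembling\<close>

theorem proposition7:
  fixes I :: "'i set"
    and J :: "nat set"
    and \<omega> :: "nat \<Rightarrow> 'i set"
    and N :: "('i \<Rightarrow> real) measure"
    and \<pi> :: "(('i \<Rightarrow> real) \<times> 'i set) measure"
    and p :: "nat \<Rightarrow> ('i \<Rightarrow> real) \<Rightarrow> real"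
    and q :: "'i set pmf"
    and lam :: real
    and A :: "('i \<rightharpoonup> real) \<Rightarrow> real"
  assumes masks_subset: "\<And>i. i \<in> J \<Longrightarrow> \<omega> i \<subseteq> I"
    and masks_distinct: "inj_on \<omega> J"
    and space_N: "space N = I \<rightarrow>\<^sub>E UNIV"
    and prob_\<pi>: "prob_space \<pi>"
    and sets_\<pi>: "sets \<pi> = sets (N \<Otimes>\<^sub>M count_space (\<omega> ` J))"
    and cond_prob: "\<And>i. i \<in> J \<Longrightarrow>
          is_cond_prob_given \<pi> N fst {x \<in> space \<pi>. snd x = \<omega> i} (p i)"
    and q_masks: "set_pmf q \<subseteq> \<omega> ` J"
    and lam_pos: "lam > 0"
    and A_range: "\<And>x. dom x \<subseteq> I \<Longrightarrow> A x \<in> {0..1}"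
    and A_measurable: "\<And>F. finite F \<Longrightarrow> F \<subseteq> J \<Longrightarrow>
          (\<lambda>z. A (observed z (I \<inter> (\<Inter>i\<in>F. \<omega> i)))) \<in> borel_measurable N"
  shows "(\<integral>\<^sup>+ (z, w). ennreal ((PM I q lam A (observed z I) - PM I q lam A (observed z w))\<^sup>2) \<partial>\<pi>)
       \<le> (\<integral>\<^sup>+ z. (\<Squnion>i\<in>J. ennreal (p i z) / ennreal (pmf q (\<omega> i))) \<partial>(distr \<pi> N fst)) / ennreal lam"
proof -
  define g where "g = (\<lambda>z ws. A (observed z (mask_Inter I ws)))"
  define E :: "('i set list \<Rightarrow> real) \<Rightarrow> real"
    where "E = measure_pmf.expectation (poissonized_masks lam q)"
  define \<psi> where "\<psi> = (\<lambda>z w. (E (g z) - E (\<lambda>ws. g z (w # ws)))\<^sup>2)"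
  define S where "S = (\<lambda>z. \<Squnion>i\<in>J. ennreal (p i z) / ennreal (pmf q (\<omega> i)))"

  have g_range: "g z ws \<in> {0..1}" for z ws
    unfolding g_def by (rule A_range) (auto simp: observed_def mask_Inter_def)
  have g_sym: "g z xs = g z ys" if "mset xs = mset ys" for z xs ys
    using mset_eq_setD[OF that] by (simp add: g_def mask_Inter_def)
  have g_meas: "(\<lambda>z. g z ws) \<in> borel_measurable N" if "set ws \<subseteq> \<omega> ` J" for ws
  proof -
    obtain F where "finite F" "F \<subseteq> J" "set ws = \<omega> ` F"
      using finite_subset_image[OF finite_set \<open>set ws \<subseteq> \<omega> ` J\<close>] by blast
    with A_measurable[of F] show ?thesis
      by (simp add: g_def mask_Inter_def)
  qed
  have set_masks: "set ws \<subseteq> \<omega> ` J" if "ws \<in> set_pmf (poissonized_masks lam q)" for ws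
    using that q_masks by (auto simp: poissonized_masks_def set_replicate_pmf)
  have E_unit: "E f \<in> {0..1}" if "\<And>ws. f ws \<in> {0..1}" for f
    unfolding E_def using that by (rule expectation_pmf_unit_interval)
  have \<psi>_le: "\<psi> z w \<le> 1" for z w
  proof -
    have "\<bar>E (g z) - E (\<lambda>ws. g z (w # ws))\<bar> \<le> 1"
      using E_unit[of "g z"] E_unit[of "\<lambda>ws. g z (w # ws)"] g_range by (auto simp: abs_le_iff)
    then show ?thesis by (simp add: \<psi>_def abs_square_le_1)
  qed
  have \<psi>_meas: "(\<lambda>z. \<psi> z (\<omega> i)) \<in> borel_measurable N" if "i \<in> J" for i
  proof -
    have "(\<lambda>z. E (g z)) \<in> borel_measurable N" "(\<lambda>z. E (\<lambda>ws. g z (\<omega> i # ws))) \<in> borel_measurable N"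
      unfolding E_def by (intro borel_measurable_expectation_pmf g_meas; use set_masks that in force)+
    then show ?thesis
      unfolding \<psi>_def by measurable
  qed

  have PM_full: "PM I q lam A (observed z I) = E (g z)" for z
    by (simp add: PM_def E_def g_def observed_def mask_Inter_def Int_absorb1 Int_assoc[symmetric])
  \<comment> \<open>Masking the input by \<open>w\<close> is the same as adding \<open>w\<close> to the list of sampled masks.\<close>
  have PM_masked: "PM I q lam A (observed z w) = E (\<lambda>ws. g z (w # ws))" if "w \<subseteq> I" for z w
  proof -
    have "w \<inter> (I \<inter> \<Inter>(set ws)) = I \<inter> (w \<inter> \<Inter>(set ws))" for ws
      by blast
    then show ?thesis
      by (simp add: PM_def E_def g_def observed_def mask_Inter_def)
  qed

  interpret prob_space \<pi> by (rule prob_\<pi>)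
  have space_\<pi>: "space \<pi> = space N \<times> \<omega> ` J"
    using sets_eq_imp_space_eq[OF sets_\<pi>] by (simp add: space_pair_measure)
  have fst_meas: "fst \<in> measurable \<pi> N"
    unfolding measurable_cong_sets[OF sets_\<pi> refl] by (rule measurable_fst)
  have event: "{x \<in> space \<pi>. snd x = \<omega> i} \<in> sets \<pi>" if "i \<in> J" for i
  proof -
    have snd_meas: "snd \<in> measurable \<pi> (count_space (\<omega> ` J))"
      unfolding measurable_cong_sets[OF sets_\<pi> refl] by (rule measurable_snd)
    have "snd -` {\<omega> i} \<inter> space \<pi> \<in> sets \<pi>"
      by (rule measurable_sets[OF snd_meas]) (use that in simp)
    also have "snd -` {\<omega> i} \<inter> space \<pi> = {x \<in> space \<pi>. snd x = \<omega> i}"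
      by blast
    finally show ?thesis .
  qed
  have p_meas: "p i \<in> borel_measurable N" if "i \<in> J" for i
    using cond_prob[OF that] by (simp add: is_cond_prob_given_def)
  have S_meas: "S \<in> borel_measurable N"
    unfolding S_def
    by (intro borel_measurable_SUP borel_measurable_divide_ennreal borel_measurable_const
          measurable_compose[OF p_meas measurable_ennreal]) auto

  have "(\<integral>\<^sup>+ (z, w). ennreal ((PM I q lam A (observed z I) - PM I q lam A (observed z w))\<^sup>2) \<partial>\<pi>) =
      (\<integral>\<^sup>+x. (\<integral>\<^sup>+i. ennreal (\<psi> (fst x) (\<omega> i)) * indicator {x \<in> space \<pi>. snd x = \<omega> i} x \<partial>count_space J) \<partial>\<pi>)"
  proof (rule nn_integral_cong)
    \<comment> \<open>As \<open>\<omega>\<close> is injective on \<open>J\<close>, exactly one index contributes.\<close>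
    fix x assume x: "x \<in> space \<pi>"
    then obtain j where j: "j \<in> J" "snd x = \<omega> j"
      by (auto simp: space_\<pi>)
    have "(\<integral>\<^sup>+i. ennreal (\<psi> (fst x) (\<omega> i)) * indicator {x \<in> space \<pi>. snd x = \<omega> i} x \<partial>count_space J) =
        (\<integral>\<^sup>+i. ennreal (\<psi> (fst x) (\<omega> i)) * indicator {j} i \<partial>count_space J)"
      using j x masks_distinct by (intro nn_integral_cong) (auto simp: indicator_def inj_on_def)
    also have "\<dots> = ennreal (\<psi> (fst x) (\<omega> j))"
      using j by (subst nn_integral_indicator_singleton) auto
    finally show "(case x of (z, w) \<Rightarrow>
          ennreal ((PM I q lam A (observed z I) - PM I q lam A (observed z w))\<^sup>2)) =
        (\<integral>\<^sup>+i. ennreal (\<psi> (fst x) (\<omega> i)) * indicator {x \<in> space \<pi>. snd x = \<omega> i} x \<partial>count_space J)"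
      using j masks_subset[of j] by (simp add: case_prod_beta PM_full PM_masked \<psi>_def)
  qed
  also have "\<dots> = (\<integral>\<^sup>+i. (\<integral>\<^sup>+x. ennreal (\<psi> (fst x) (\<omega> i)) * indicator {x \<in> space \<pi>. snd x = \<omega> i} x \<partial>\<pi>) \<partial>count_space J)"
    by (intro nn_integral_count_space_nn_integral borel_measurable_times_ennreal
          borel_measurable_indicator event measurable_compose[OF _ measurable_ennreal]
          measurable_compose[OF fst_meas \<psi>_meas]) auto
  also have "\<dots> = (\<integral>\<^sup>+i. (\<integral>\<^sup>+x. ennreal (\<psi> (fst x) (\<omega> i)) * ennreal (p i (fst x)) \<partial>\<pi>) \<partial>count_space J)"
    by (intro nn_integral_cong nn_integral_cond_prob[OF prob_\<pi> fst_meas event cond_prob]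
          measurable_compose[OF \<psi>_meas measurable_ennreal]) auto
  also have "\<dots> = (\<integral>\<^sup>+x. (\<integral>\<^sup>+i. ennreal (\<psi> (fst x) (\<omega> i)) * ennreal (p i (fst x)) \<partial>count_space J) \<partial>\<pi>)"
    by (intro nn_integral_count_space_nn_integral[symmetric] borel_measurable_times_ennreal
          measurable_compose[OF _ measurable_ennreal]
          measurable_compose[OF fst_meas \<psi>_meas] measurable_compose[OF fst_meas p_meas]) auto
  also have "\<dots> \<le> (\<integral>\<^sup>+x. S (fst x) / ennreal lam \<partial>\<pi>)"
    unfolding S_def
  proof (intro nn_integral_mono weighted_sum_le_Sup_ratio[OF masks_distinct q_masks _ \<psi>_le _ lam_pos])
    show "measure_pmf.expectation q (\<psi> (fst x)) \<le> 1 / lam" for x :: "('i \<Rightarrow> real) \<times> 'i set"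
      unfolding \<psi>_def E_def
      by (rule poissonized_masks_insertion_bound[OF lam_pos]) (erule g_sym | rule g_range)+
  qed (auto simp: \<psi>_def)
  also have "\<dots> = (\<integral>\<^sup>+x. S (fst x) \<partial>\<pi>) / ennreal lam"
    by (intro nn_integral_divide measurable_compose[OF fst_meas S_meas])
  also have "(\<integral>\<^sup>+x. S (fst x) \<partial>\<pi>) = (\<integral>\<^sup>+z. S z \<partial>distr \<pi> N fst)"
    by (rule nn_integral_distr[symmetric]) (simp_all add: fst_meas S_meas)
  finally show ?thesis
    by (simp add: S_def)
qed

end
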